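(* Let $0<p\le1$ and let $w$ be a weight on $\mathbb{R}^n$ with $w\in RH_{(\frac1p)'}$. Then there is a constant $C$ such that for all sequences of cubes $\{Q_k\}$ and all sequences of non-negative functions $\{g_k\}$ with $\operatorname{supp}(g_k)\subset Q_k$, $$\left\|\sum_k g_k\right\|_{L^p(w)}\le C\left\|\sum_k\left(\frac1{|Q_k|}\int_{Q_k}g_k\,dy\right)\chi_{Q_k}\right\|_{L^p(w)}.$$
   Context: Cubes have sides parallel to the coordinate axes. A weight is a non-negative locally integrable function $w$ with $0<w<\infty$ a.e. For $1<s<\infty$, $w\in RH_s$ if there is $C$ with $\left(\frac1{|Q|}\int_Q w^s\,dx\right)^{1/s}\le C\,\frac1{|Q|}\int_Q w\,dx$ for every cube $Q$; $w\in RH_\infty$ if there is $C$ with $w(x)\le C\,\frac1{|Q|}\int_Q w\,dx$ for every cube $Q$ and a.e. $x\in Q$. $s'$ is the conjugate exponent, $\frac1s+\frac1{s'}=1$, with $1'=\infty$ (so for $p=1$ the hypothesis is $w\in RH_\infty$). $\|f\|_{L^p(w)}=\left(\int_{\mathbb{R}^n}|f|^pw\,dx\right)^{1/p}$. *)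

theory Defs
  imports "HOL-Analysis.Analysis"
begin

text \<open>
  Non-negative functions take values in \<open>[0, \<infinity>]\<close>, so that their averages, their (countable) sums
  and their weighted norms, any of which may be infinite, are always defined.
\<close>

text \<open>Only positive exponents \<open>r\<close> are used below; \<open>0\<close> and \<open>\<infinity>\<close> are then fixed points.\<close>

definition enn_powr :: "ennreal \<Rightarrow> real \<Rightarrow> ennreal"
  where "enn_powr x r = (if x = \<infinity> then \<infinity> else ennreal (enn2real x powr r))"

lemma enn_powr_ennreal: "0 \<le> x \<Longrightarrow> enn_powr (ennreal x) r = ennreal (x powr r)"
  by (simp add: enn_powr_def)

lemma enn_powr_0 [simp]: "enn_powr 0 r = 0"
  by (simp add: enn_powr_def)

lemma enn_powr_top [simp]: "enn_powr \<infinity> r = \<infinity>"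
  by (simp add: enn_powr_def)

text \<open>Cubes are closed, non-degenerate, with sides parallel to the coordinate axes.\<close>

definition is_cube :: "(real ^ 'n) set \<Rightarrow> bool"
  where "is_cube Q \<longleftrightarrow> (\<exists>a l. 0 < l \<and> Q = cbox a (a + vec l))"

definition average :: "(real ^ 'n) set \<Rightarrow> (real ^ 'n \<Rightarrow> ennreal) \<Rightarrow> ennreal"
  where "average Q f = (\<integral>\<^sup>+x\<in>Q. f x \<partial>lebesgue) / emeasure lebesgue Q"

definition weight :: "(real ^ 'n \<Rightarrow> ennreal) \<Rightarrow> bool"
  where "weight w \<longleftrightarrow>
    w \<in> borel_measurable lebesgue \<and>
    (\<forall>K. compact K \<longrightarrow> (\<integral>\<^sup>+x\<in>K. w x \<partial>lebesgue) < \<infinity>) \<and>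
    (AE x in lebesgue. 0 < w x \<and> w x < \<infinity>)"

text \<open>
  The class \<open>RH\<^sub>s\<close>, for \<open>1 < s \<le> \<infinity>\<close>.  The constant is a real number, i.e. finite.
\<close>

definition reverse_Holder :: "ennreal \<Rightarrow> (real ^ 'n \<Rightarrow> ennreal) \<Rightarrow> bool"
  where "reverse_Holder s w \<longleftrightarrow>
    (if s = \<infinity> then
       (\<exists>C::real. \<forall>Q. is_cube Q \<longrightarrow>
          (AE x in lebesgue. x \<in> Q \<longrightarrow> w x \<le> ennreal C * average Q w))
     else
       (\<exists>C::real. \<forall>Q. is_cube Q \<longrightarrow>
          enn_powr (average Q (\<lambda>x. enn_powr (w x) (enn2real s))) (1 / enn2real s)
            \<le> ennreal C * average Q w))"

text \<open>
  The exponent \<open>s'\<close> with \<open>1/s + 1/s' = 1\<close>, for \<open>1 \<le> s \<le> \<infinity>\<close>, where \<open>1/\<infinity> = 0\<close> and \<open>1/0 = \<infinity>\<close>.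
\<close>

definition conj_exponent :: "ennreal \<Rightarrow> ennreal"
  where "conj_exponent s = inverse (1 - inverse s)"

lemma conj_exponent_1: "conj_exponent 1 = \<infinity>"
  by (simp add: conj_exponent_def)

lemma conj_exponent_ennreal:
  assumes "1 < s"
  shows "conj_exponent (ennreal s) = ennreal (s / (s - 1))"
proof -
  have "inverse s < 1"
    using assms by (simp add: field_simps)
  then have "conj_exponent (ennreal s) = ennreal (inverse (1 - inverse s))"
    using assms by (simp add: conj_exponent_def inverse_ennreal ennreal_minus flip: ennreal_1)
  also have "inverse (1 - inverse s) = s / (s - 1)"
    using assms by (simp add: field_simps)
  finally show ?thesis .
qed

definition weighted_Lp_norm :: "real \<Rightarrow> (real ^ 'n \<Rightarrow> ennreal) \<Rightarrow> (real ^ 'n \<Rightarrow> ennreal) \<Rightarrow> ennreal"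
  where "weighted_Lp_norm p w f = enn_powr (\<integral>\<^sup>+x. enn_powr (f x) p * w x \<partial>lebesgue) (1 / p)"

end

theory Submission
  imports Defs
begin

text \<open>
  Put \<open>\<nu> = w dx\<close>.  By Hoelder's inequality the reverse Hoelder condition gives, for every cube \<open>Q\<close> and
  every non-negative \<open>f\<close>,
  \<open>\<integral>\<^sub>Q f\<^sup>p d\<nu> \<le> A (avg\<^sub>Q f)\<^sup>p \<nu>(Q)\<close>  (lemma \<open>concave_mean_le_of_reverse_Holder\<close>),
  and this local inequality carries the rest of the argument.  Applied to indicator functions it yields an \<open>\<epsilon> > 0\<close> such that removing from a cube a set of relative Lebesgue
  measure at most \<open>\<epsilon>\<close> leaves at least half of its \<open>\<nu>\<close>-mass (\<open>measure_most_of_cube\<close>); in particular \<open>\<nu>\<close> is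
  doubling on cubes (\<open>doubling\<close>).

  Let \<open>G = \<Sum>\<^sub>k a\<^sub>k \<chi>\<^bsub>Q\<^sub>k\<^esub>\<close> with \<open>a\<^sub>k\<close> the average of \<open>g\<^sub>k\<close>, for a finite family.  Each cube \<open>Q\<^sub>k\<close> is assigned to
  a dyadic level \<open>t = t\<^sub>0 2\<^sup>n\<close> which is essentially the \<open>\<epsilon>\<close>-quantile of \<open>G\<close> on \<open>Q\<^sub>k\<close>: all but a portion \<open>\<epsilon>\<close>
  of \<open>Q\<^sub>k\<close> lies in \<open>{G > t}\<close>, while \<open>G \<le> 2t\<close> on at least a portion \<open>\<epsilon>\<close> of \<open>Q\<^sub>k\<close> (\<open>exists_level\<close>).  This replaces
  the ordering of the cubes by inclusion that would be available if they were dyadic.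

  Consider the cubes of one level which lie in the triple \<open>R = 3S\<close> of a cube \<open>S\<close> of that level.  Their
  functions have total mass \<open>\<Sum> a\<^sub>k |Q\<^sub>k| \<le> \<epsilon>\<^sup>-\<^sup>1 \<Sum> a\<^sub>k |Q\<^sub>k \<inter> {G \<le> 2t}| \<le> 2t |R| / \<epsilon>\<close>, so the local inequality on
  \<open>R\<close> bounds the integral of the \<open>p\<close>-th power of their sum by a constant times
  \<open>t\<^sup>p \<nu>(R)\<close>, hence times \<open>t\<^sup>p \<nu>(S \<inter> {G > t})\<close> (\<open>cluster_estimate\<close>).  A Vitali selection of disjoint
  cubes \<open>S\<close> gives the bound \<open>t\<^sup>p \<nu>{G > t}\<close> for the whole level (\<open>level_estimate\<close>).  Since
  \<open>(x + y)\<^sup>p \<le> x\<^sup>p + y\<^sup>p\<close> for \<open>p \<le> 1\<close>, the levels may be summed, and \<open>\<Sum> t\<^sup>p \<nu>{G > t}\<close> over the dyadic levels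
  is at most a constant times \<open>\<integral> G\<^sup>p d\<nu>\<close> (\<open>finite_sum_estimate\<close>).  The constants do not depend on the
  family, so monotone convergence gives the inequality for sequences (\<open>sum_estimate\<close>).
\<close>

section \<open>Powers of extended non-negative numbers\<close>

lemma enn_powr_top' [simp]: "enn_powr top r = top"
  using enn_powr_top by simp

lemma enn_powr_1 [simp]: "enn_powr x 1 = x"
  by (cases x) (auto simp: enn_powr_def)

lemma enn_powr_pos: "0 < x \<Longrightarrow> 0 < enn_powr x r"
  by (cases x) (auto simp: enn_powr_def)

lemma enn_powr_mono:
  assumes "0 < r" "x \<le> y"
  shows "enn_powr x r \<le> enn_powr y r"
  using assms by (cases x; cases y) (auto simp: enn_powr_def top_unique intro!: ennreal_leI powr_mono2)

lemma enn_powr_mult: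
  assumes "0 < r"
  shows "enn_powr (x * y) r = enn_powr x r * enn_powr y r"
  by (cases x; cases y)
    (auto simp: enn_powr_def ennreal_mult_eq_top_iff ennreal_top_mult ennreal_mult_top powr_mult
      ennreal_zero_less_mult_iff simp flip: ennreal_mult)

lemma enn_powr_enn_powr: "enn_powr (enn_powr x r) s = enn_powr x (r * s)"
  by (cases x) (auto simp: enn_powr_def powr_powr)

lemma enn_powr_inverse:
  assumes "0 < r"
  shows "enn_powr (enn_powr x r) (1 / r) = x" "enn_powr (enn_powr x (1 / r)) r = x"
  using assms by (simp_all add: enn_powr_enn_powr)

lemma enn_powr_indicator: "0 < r \<Longrightarrow> enn_powr (indicator A x) r = indicator A x"
  by (auto simp: indicator_def enn_powr_def)

lemma borel_measurable_enn_powr [measurable (raw)]: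
  assumes [measurable]: "f \<in> borel_measurable M"
  shows "(\<lambda>x. enn_powr (f x) r) \<in> borel_measurable M"
  unfolding enn_powr_def by measurable

lemma enn_powr_add_le:
  assumes "0 < r" "r \<le> 1"
  shows "enn_powr (x + y) r \<le> enn_powr x r + enn_powr y r"
proof -
  have *: "(a + b) powr r \<le> a powr r + b powr r" if "0 \<le> a" "0 \<le> b" for a b :: real
  proof (cases "a + b = 0")
    case False
    then have ab: "0 < a + b"
      using that by simp
    have frac: "t \<le> t powr r" if "0 \<le> t" "t \<le> 1" for t :: real
      using powr_mono'[of r 1 t] assms that by simp
    have "1 = a / (a + b) + b / (a + b)"
      using ab by (simp flip: add_divide_distrib)
    also have "\<dots> \<le> (a / (a + b)) powr r + (b / (a + b)) powr r"
      using that ab by (intro add_mono frac) auto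
    also have "\<dots> = (a powr r + b powr r) / (a + b) powr r"
      using that by (simp add: powr_divide add_divide_distrib)
    finally show ?thesis
      using ab by (simp add: field_simps)
  qed (use that in auto)
  show ?thesis
    by (cases x; cases y) (auto simp: enn_powr_def * simp flip: ennreal_plus intro!: ennreal_leI)
qed

lemma enn_powr_sum_le:
  assumes "0 < r" "r \<le> 1" "finite K"
  shows "enn_powr (\<Sum>k\<in>K. f k) r \<le> (\<Sum>k\<in>K. enn_powr (f k) r)"
  using assms(3)
proof induction
  case (insert k K)
  then show ?case
    using enn_powr_add_le[OF assms(1,2), of "f k" "sum f K"]
    by (auto intro: order_trans add_left_mono)
qed auto

text \<open>The power is an order automorphism of \<open>[0, \<infinity>]\<close>, so it commutes with suprema.\<close>

lemma enn_powr_SUP_le: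
  assumes "0 < r"
  shows "enn_powr (SUP i\<in>I. f i) r \<le> (SUP i\<in>I. enn_powr (f i) r)"
proof -
  have "(SUP i\<in>I. f i) \<le> enn_powr (SUP i\<in>I. enn_powr (f i) r) (1 / r)"
  proof (rule SUP_least)
    fix i assume "i \<in> I"
    then have "enn_powr (f i) r \<le> (SUP i\<in>I. enn_powr (f i) r)"
      by (rule SUP_upper)
    from enn_powr_mono[OF _ this, of "1 / r"]
    show "f i \<le> enn_powr (SUP i\<in>I. enn_powr (f i) r) (1 / r)"
      using assms by (simp add: enn_powr_inverse)
  qed
  from enn_powr_mono[OF assms this] show ?thesis
    using assms by (simp add: enn_powr_inverse)
qed

lemma enn_powr_young:
  assumes "0 < r" "r < 1"
  shows "enn_powr x r * enn_powr y (1 - r) \<le> ennreal r * x + ennreal (1 - r) * y"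
proof (cases "x = 0 \<or> y = 0 \<or> x = \<infinity> \<or> y = \<infinity>")
  case True
  then show ?thesis
    using assms by (auto simp: ennreal_mult_top)
next
  case False
  then obtain a b where ab: "x = ennreal a" "y = ennreal b" "0 < a" "0 < b"
    by (cases x; cases y) (auto simp: less_le)
  have "a powr r * b powr (1 - r) \<le> r * a + (1 - r) * b"
    using Youngs_inequality_0[of r "1 - r" a b] assms ab by simp
  then show ?thesis
    using assms ab
    by (simp add: enn_powr_ennreal ennreal_leI flip: ennreal_mult ennreal_plus)
qed

text \<open>
  Hoelder's inequality for the conjugate exponents \<open>1 / r\<close> and \<open>1 / (1 - r)\<close>: after normalising both
  integrals to \<open>1\<close> it is the integrated Young inequality.  Integrals that are \<open>0\<close> or \<open>\<infinity>\<close> cannot be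
  normalised and are treated apart.
\<close>

lemma nn_integral_Holder_interpolation:
  assumes "0 < r" "r < 1"
    and [measurable]: "f \<in> borel_measurable M" "h \<in> borel_measurable M"
  shows "(\<integral>\<^sup>+x. enn_powr (f x) r * enn_powr (h x) (1 - r) \<partial>M)
    \<le> enn_powr (\<integral>\<^sup>+x. f x \<partial>M) r * enn_powr (\<integral>\<^sup>+x. h x \<partial>M) (1 - r)"
    (is "?I \<le> enn_powr ?A r * enn_powr ?B (1 - r)")
proof -
  have "?I = 0" if "?A = 0 \<or> ?B = 0"
  proof -
    have "AE x in M. enn_powr (f x) r * enn_powr (h x) (1 - r) = 0"
      using that by (auto simp: nn_integral_0_iff_AE)
    then show ?thesis
      by (subst nn_integral_0_iff_AE) auto
  qed
  moreover have ?thesis if "?A \<noteq> 0" "?B \<noteq> 0" "?A = \<infinity> \<or> ?B = \<infinity>"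
  proof -
    have "enn_powr ?A r * enn_powr ?B (1 - r) = top"
      using that enn_powr_pos[of ?A r] enn_powr_pos[of ?B "1 - r"]
      by (auto simp: ennreal_mult_eq_top_iff zero_less_iff_neq_zero)
    then show ?thesis
      by simp
  qed
  moreover have ?thesis if nz: "?A \<noteq> 0" "?B \<noteq> 0" and fin: "?A \<noteq> \<infinity>" "?B \<noteq> \<infinity>"
  proof -
    obtain a b where a: "?A = ennreal a" "0 < a" and b: "?B = ennreal b" "0 < b"
      using nz fin by (cases ?A; cases ?B) (auto simp: less_le)
    let ?a = "ennreal (1 / a)" and ?b = "ennreal (1 / b)"
    have "enn_powr ?a r * enn_powr ?b (1 - r) * ?I
        = (\<integral>\<^sup>+x. enn_powr (?a * f x) r * enn_powr (?b * h x) (1 - r) \<partial>M)"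
      using assms by (simp add: enn_powr_mult mult_ac flip: nn_integral_cmult)
    also have "\<dots> \<le> (\<integral>\<^sup>+x. ennreal r * (?a * f x) + ennreal (1 - r) * (?b * h x) \<partial>M)"
      by (intro nn_integral_mono enn_powr_young assms)
    also have "\<dots> = ennreal r * (?a * ?A) + ennreal (1 - r) * (?b * ?B)"
      by (simp add: nn_integral_add nn_integral_cmult)
    also have "\<dots> = 1"
      using a b assms by (simp flip: ennreal_mult ennreal_plus)
    finally have *: "enn_powr ?a r * enn_powr ?b (1 - r) * ?I \<le> 1" .
    have "?I = enn_powr (?A * ?a) r * enn_powr (?B * ?b) (1 - r) * ?I"
      using a b by (simp add: enn_powr_def flip: ennreal_mult)
    also have "\<dots> = (enn_powr ?A r * enn_powr ?B (1 - r)) * (enn_powr ?a r * enn_powr ?b (1 - r) * ?I)"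
      using assms by (simp add: enn_powr_mult mult_ac)
    also have "\<dots> \<le> (enn_powr ?A r * enn_powr ?B (1 - r)) * 1"
      by (intro mult_left_mono *) simp
    finally show ?thesis by simp
  qed
  ultimately show ?thesis
    by fastforce
qed

section \<open>Cubes\<close>

text \<open>
  With this rule the simplifier would replace the Lebesgue measure of a set by the Borel measure of
  its main part.
\<close>

declare emeasure_completion [simp del]

text \<open>
  Cubes are parametrised by centre and half side, since concentric dilations drive the doubling
  argument and the covering argument.
\<close>

definition cube :: "real ^ 'n \<Rightarrow> real \<Rightarrow> (real ^ 'n) set"
  where "cube c r = cbox (c - vec r) (c + vec r)"

lemma is_cube_iff: "is_cube Q \<longleftrightarrow> (\<exists>c r. 0 < r \<and> Q = cube c r)"
proof
  assume "is_cube Q"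
  then obtain a l where l: "0 < l" "Q = cbox a (a + vec l)"
    by (auto simp: is_cube_def)
  then have "Q = cube (a + vec (l / 2)) (l / 2)"
    by (auto simp: cube_def mem_box_cart field_simps)
  with l show "\<exists>c r. 0 < r \<and> Q = cube c r"
    by (intro exI[of _ "a + vec (l / 2)"] exI[of _ "l / 2"]) auto
next
  assume "\<exists>c r. 0 < r \<and> Q = cube c r"
  then obtain c r where r: "0 < r" "Q = cube c r"
    by auto
  then have "Q = cbox (c - vec r) (c - vec r + vec (2 * r))"
    by (auto simp: cube_def mem_box_cart algebra_simps)
  with r show "is_cube Q"
    unfolding is_cube_def by (intro exI[of _ "c - vec r"] exI[of _ "2 * r"]) auto
qed

lemma is_cube_cube: "0 < r \<Longrightarrow> is_cube (cube c r)"
  by (auto simp: is_cube_iff)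

lemma mem_cube: "x \<in> cube c r \<longleftrightarrow> (\<forall>i. \<bar>x $ i - c $ i\<bar> \<le> r)"
  by (auto simp: cube_def mem_box_cart abs_le_iff algebra_simps)

lemma cube_sets [measurable, simp]: "cube c r \<in> sets lebesgue"
  by (simp add: cube_def)

lemma cube_mono: "r \<le> s \<Longrightarrow> cube c r \<subseteq> cube c s"
  unfolding mem_cube subset_iff by (meson order_trans)

text \<open>
  The geometric half of the Vitali covering argument: a cube is engulfed by the triple of any cube
  that it meets and that is at least as large.
\<close>

lemma cube_subset_triple:
  assumes "cube d s \<inter> cube c r \<noteq> {}" "s \<le> r"
  shows "cube d s \<subseteq> cube c (3 * r)"
proof
  fix x assume x: "x \<in> cube d s"
  obtain z where z: "z \<in> cube d s" "z \<in> cube c r"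
    using assms by auto
  show "x \<in> cube c (3 * r)"
    unfolding mem_cube
  proof
    fix i
    have "\<bar>x $ i - d $ i\<bar> \<le> s" "\<bar>z $ i - d $ i\<bar> \<le> s" "\<bar>z $ i - c $ i\<bar> \<le> r"
      using x z by (auto simp: mem_cube)
    then show "\<bar>x $ i - c $ i\<bar> \<le> 3 * r"
      using \<open>s \<le> r\<close> by linarith
  qed
qed

lemma emeasure_cube:
  assumes "0 < r"
  shows "emeasure lebesgue (cube c r :: (real ^ 'n) set) = ennreal ((2 * r) ^ CARD('n))"
proof -
  have ne: "cube c r \<noteq> {}"
  proof -
    have "c \<in> cube c r"
      using assms by (simp add: mem_cube)
    then show ?thesis
      by auto
  qed
  have "measure lebesgue (cube c r) = (\<Prod>i\<in>(UNIV :: 'n set). 2 * r)"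
    using ne by (simp add: cube_def content_cbox_cart measure_completion)
  moreover have "emeasure lebesgue (cube c r) \<noteq> \<infinity>"
    using emeasure_lborel_cbox_finite[of "c - vec r" "c + vec r"]
    by (simp add: cube_def emeasure_completion)
  ultimately show ?thesis
    by (simp add: emeasure_eq_ennreal_measure)
qed

lemma is_cube_sets [simp]: "is_cube Q \<Longrightarrow> Q \<in> sets lebesgue"
  by (auto simp: is_cube_def)

lemma emeasure_is_cube:
  assumes "is_cube (Q :: (real ^ 'n) set)"
  obtains v where "0 < v" "emeasure lebesgue Q = ennreal v"
proof -
  obtain c r where "0 < r" "Q = cube c r"
    using assms by (auto simp: is_cube_iff)
  with that[of "(2 * r) ^ CARD('n)"] show thesis
    by (simp add: emeasure_cube)
qed

lemma average_mult_emeasure: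
  assumes "is_cube Q"
  shows "average Q f * emeasure lebesgue Q = (\<integral>\<^sup>+x\<in>Q. f x \<partial>lebesgue)"
proof -
  obtain v where "0 < v" "emeasure lebesgue Q = ennreal v"
    using emeasure_is_cube[OF assms] .
  then show ?thesis
    unfolding average_def
    by (simp add: divide_ennreal_def mult.assoc inverse_ennreal flip: ennreal_mult)
qed

section \<open>Measures for which concave means are controlled by averages\<close>

text \<open>
  The inequality \<open>concave_mean\<close> is the form in which the reverse Hoelder condition on \<open>w\<close> enters, with
  \<open>\<nu> = w dx\<close>.  It is local, one cube at a time; the rest of the argument globalises it.  The
  normalisation \<open>1 \<le> A\<close> keeps the proportion \<open>eps\<close> below at most \<open>1\<close>.
\<close>

locale concave_averaging =
  fixes p A :: real and \<nu> :: "(real ^ 'n) measure"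
  assumes p: "0 < p" "p \<le> 1" and A: "1 \<le> A"
    and sets_nu [measurable_cong]: "sets \<nu> = sets lebesgue"
    and finite_cube: "is_cube Q \<Longrightarrow> emeasure \<nu> Q < \<infinity>"
    and concave_mean: "is_cube Q \<Longrightarrow> f \<in> borel_measurable lebesgue \<Longrightarrow>
      (\<integral>\<^sup>+x\<in>Q. enn_powr (f x) p \<partial>\<nu>) \<le> ennreal A * enn_powr (average Q f) p * emeasure \<nu> Q"
begin

text \<open>
  A subset of relative Lebesgue measure \<open>eps\<close> in a cube carries at most half of the \<open>\<nu>\<close>-mass of that
  cube, because \<open>A * eps powr p = 1 / 2\<close>.
\<close>

definition eps :: real
  where "eps = (1 / (2 * A)) powr (1 / p)"

lemma eps: "0 < eps" "eps \<le> 1"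
proof -
  show "0 < eps"
    using A by (simp add: eps_def)
  have "(1 / (2 * A)) powr (1 / p) \<le> 1 powr (1 / p)"
    using A p by (intro powr_mono2) auto
  then show "eps \<le> 1"
    by (simp add: eps_def)
qed

lemma A_eps: "A * eps powr p = 1 / 2"
  using A p by (simp add: eps_def powr_powr)

text \<open>
  Apply \<open>concave_mean\<close> to the indicator of the exceptional set: \<open>\<nu> (Q - E)\<close> is at most half of
  \<open>\<nu> Q\<close>, which is finite and can be absorbed.
\<close>

lemma measure_most_of_cube:
  assumes Q: "is_cube Q" and [measurable]: "E \<in> sets lebesgue"
    and small: "emeasure lebesgue (Q - E) \<le> ennreal eps * emeasure lebesgue Q"
  shows "emeasure \<nu> Q \<le> 2 * emeasure \<nu> (Q \<inter> E)"
proof -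
  have [measurable]: "Q \<in> sets lebesgue"
    using Q by simp
  obtain v where v: "0 < v" "emeasure lebesgue Q = ennreal v"
    using emeasure_is_cube[OF Q] .
  have "average Q (indicator (Q - E)) = emeasure lebesgue (Q - E) / ennreal v"
    unfolding average_def v indicator_inter_arith[symmetric] by (simp add: Int_absorb2)
  also have "\<dots> \<le> ennreal eps * ennreal v / ennreal v"
    using small v by (intro divide_right_mono_ennreal) simp
  also have "\<dots> = ennreal eps"
    using v by (simp add: ennreal_mult_divide_eq)
  finally have avg: "average Q (indicator (Q - E)) \<le> ennreal eps" .
  have "emeasure \<nu> (Q - E) = (\<integral>\<^sup>+x\<in>Q. enn_powr (indicator (Q - E) x) p \<partial>\<nu>)"
    unfolding enn_powr_indicator[OF p(1)] indicator_inter_arith[symmetric]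
    by (simp add: Int_absorb2 sets_nu)
  also have "\<dots> \<le> ennreal A * enn_powr (average Q (indicator (Q - E))) p * emeasure \<nu> Q"
    by (rule concave_mean) (use Q in auto)
  also have "\<dots> \<le> ennreal A * enn_powr (ennreal eps) p * emeasure \<nu> Q"
    by (intro mult_right_mono mult_left_mono enn_powr_mono p avg) auto
  also have "ennreal A * enn_powr (ennreal eps) p = ennreal (1 / 2)"
    using A eps unfolding A_eps[symmetric] by (simp add: enn_powr_ennreal ennreal_mult)
  finally have diff: "emeasure \<nu> (Q - E) \<le> ennreal (1 / 2) * emeasure \<nu> Q" .
  obtain m where m: "emeasure \<nu> Q = ennreal m" "0 \<le> m"
    using finite_cube[OF Q] by (cases "emeasure \<nu> Q") auto
  have fin: "emeasure \<nu> (Q \<inter> E) \<noteq> top"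
    using emeasure_mono[of "Q \<inter> E" Q \<nu>] finite_cube[OF Q]
    by (auto simp: sets_nu top_unique)
  then obtain m' where m': "emeasure \<nu> (Q \<inter> E) = ennreal m'" "0 \<le> m'"
    by (cases "emeasure \<nu> (Q \<inter> E)") auto
  have "emeasure \<nu> Q = emeasure \<nu> (Q \<inter> E) + emeasure \<nu> (Q - E)"
    by (subst plus_emeasure) (auto simp: sets_nu intro!: arg_cong[where f = "emeasure \<nu>"])
  also have "\<dots> \<le> emeasure \<nu> (Q \<inter> E) + ennreal (1 / 2) * emeasure \<nu> Q"
    by (intro add_left_mono diff)
  finally have "ennreal m \<le> ennreal (m' + m / 2)"
    using m m' by (simp only: ennreal_mult[symmetric] ennreal_plus[symmetric]) simp
  then have "m \<le> 2 * m'"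
    using m m' by (subst (asm) ennreal_le_iff) auto
  then have "ennreal m \<le> ennreal (2 * m')"
    by (rule ennreal_leI)
  then show ?thesis
    using m m' by (simp add: ennreal_mult)
qed

text \<open>
  A slight dilation of a cube creates only a small proportion of new volume, hence at most doubles
  \<open>\<nu>\<close>; finitely many slight dilations triple the cube.
\<close>

lemma doubling:
  obtains D where "0 < D" "\<And>c r. 0 < r \<Longrightarrow> emeasure \<nu> (cube c (3 * r)) \<le> ennreal D * emeasure \<nu> (cube c r)"
proof -
  define n where "n = CARD('n)"
  have n: "0 < n"
    by (simp add: n_def)
  \<comment> \<open>A dilation by the factor \<open>\<rho>\<close> adds at most the proportion \<open>eps\<close> of the larger volume.\<close>
  define \<rho> where "\<rho> = root n (1 + eps)"
  have rho_n: "\<rho> ^ n = 1 + eps"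
    using eps n by (simp add: \<rho>_def)
  have rho: "1 < \<rho>"
    using eps n by (simp add: \<rho>_def)
  have step: "emeasure \<nu> (cube c (\<rho> * r)) \<le> 2 * emeasure \<nu> (cube c r)" if r: "0 < r" for c r
  proof -
    have sub: "cube c r \<subseteq> cube c (\<rho> * r)"
      using rho r by (intro cube_mono) simp
    have "emeasure lebesgue (cube c (\<rho> * r) - cube c r)
        = ennreal ((2 * (\<rho> * r)) ^ n) - ennreal ((2 * r) ^ n)"
      using rho r sub by (subst emeasure_Diff) (auto simp: emeasure_cube n_def)
    also have "\<dots> = ennreal ((2 * (\<rho> * r)) ^ n - (2 * r) ^ n)"
      using r by (simp add: ennreal_minus)
    also have "(2 * (\<rho> * r)) ^ n - (2 * r) ^ n = eps * (2 * r) ^ n"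
      using rho_n by (simp add: power_mult_distrib algebra_simps)
    also have "ennreal (eps * (2 * r) ^ n) \<le> ennreal (eps * (2 * (\<rho> * r)) ^ n)"
      using eps rho r by (intro ennreal_leI mult_left_mono power_mono) auto
    finally have "emeasure lebesgue (cube c (\<rho> * r) - cube c r)
        \<le> ennreal eps * emeasure lebesgue (cube c (\<rho> * r))"
      using eps rho r by (simp add: emeasure_cube n_def ennreal_mult)
    from measure_most_of_cube[OF is_cube_cube _ this] show ?thesis
      using rho r sub by (simp add: Int_absorb1)
  qed
  have iterate: "emeasure \<nu> (cube c (\<rho> ^ N * r)) \<le> 2 ^ N * emeasure \<nu> (cube c r)"
    if r: "0 < r" for c r N
  proof (induction N)
    case (Suc N)
    have "emeasure \<nu> (cube c (\<rho> ^ Suc N * r)) \<le> 2 * emeasure \<nu> (cube c (\<rho> ^ N * r))"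
      using step[of "\<rho> ^ N * r" c] rho r by (simp add: mult_ac)
    also have "\<dots> \<le> 2 * (2 ^ N * emeasure \<nu> (cube c r))"
      by (intro mult_left_mono Suc) simp
    finally show ?case
      by (simp add: mult_ac)
  qed simp
  obtain N where N: "3 < \<rho> ^ N"
    using real_arch_pow[OF rho] by blast
  show ?thesis
  proof
    fix c :: "real ^ 'n" and r :: real assume r: "0 < r"
    have "emeasure \<nu> (cube c (3 * r)) \<le> emeasure \<nu> (cube c (\<rho> ^ N * r))"
      using N r by (intro emeasure_mono cube_mono) (auto simp: sets_nu)
    also have "\<dots> \<le> 2 ^ N * emeasure \<nu> (cube c r)"
      by (rule iterate[OF r])
    finally show "emeasure \<nu> (cube c (3 * r)) \<le> ennreal (2 ^ N) * emeasure \<nu> (cube c r)"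
      by (simp flip: ennreal_power)
  qed simp
qed

end

section \<open>Finite families: sorting the cubes by level\<close>

text \<open>
  The terms grow geometrically, so the sum is comparable to its last term, which is less than
  \<open>y powr p\<close>.
\<close>

lemma geometric_sum_below:
  fixes p t y :: real
  assumes "0 < p" "0 < t" "0 \<le> y"
  shows "(\<Sum>n<N. if t * 2 ^ n < y then (t * 2 ^ n) powr p else 0)
    \<le> 2 powr p / (2 powr p - 1) * y powr p"
proof (induction N)
  case 0
  have "1 \<le> 2 powr p"
    using assms by (simp add: ge_one_powr_ge_zero)
  then show ?case
    by simp
next
  case (Suc N)
  define q where "q = 2 powr p"
  have q: "1 < q"
    using assms powr_less_mono[of 0 p 2] by (simp add: q_def)
  have powr_eq: "(t * 2 ^ n) powr p = t powr p * q ^ n" for n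
    using assms by (simp add: powr_mult q_def powr_powr powr_realpow[symmetric] mult.commute)
  show ?case
  proof (cases "t * 2 ^ N < y")
    case True
    have "(\<Sum>n<Suc N. if t * 2 ^ n < y then (t * 2 ^ n) powr p else 0)
        \<le> (\<Sum>n<Suc N. t powr p * q ^ n)"
      by (intro sum_mono) (use q in \<open>auto simp: powr_eq\<close>)
    also have "\<dots> = t powr p * ((q ^ Suc N - 1) / (q - 1))"
      using q by (simp only: sum_distrib_left[symmetric] geometric_sum)
    also have "\<dots> \<le> t powr p * (q ^ Suc N / (q - 1))"
      using q by (intro mult_left_mono divide_right_mono) auto
    also have "\<dots> = q / (q - 1) * (t * 2 ^ N) powr p"
      by (simp add: powr_eq)
    also have "\<dots> \<le> q / (q - 1) * y powr p"
      using True q assms by (intro mult_left_mono powr_mono2) auto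
    finally show ?thesis
      by (simp add: q_def)
  qed (use Suc in simp)
qed

lemma geometric_sum_below_ennreal:
  fixes p t :: real and y :: ennreal
  assumes "0 < p" "0 < t"
  shows "(\<Sum>n<N. ennreal ((t * 2 ^ n) powr p) * indicator {z. ennreal (t * 2 ^ n) < z} y)
    \<le> ennreal (2 powr p / (2 powr p - 1)) * enn_powr y p"
proof -
  define c where "c = 2 powr p / (2 powr p - 1)"
  have q: "1 < 2 powr p"
    using assms powr_less_mono[of 0 p 2] by simp
  then have c: "0 < c"
    unfolding c_def by (intro divide_pos_pos) linarith+
  show ?thesis
  proof (cases y)
    case (real z)
    have "(\<Sum>n<N. ennreal ((t * 2 ^ n) powr p) * indicator {z. ennreal (t * 2 ^ n) < z} y)
        = (\<Sum>n<N. ennreal (if t * 2 ^ n < z then (t * 2 ^ n) powr p else 0))"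
      using real assms by (intro sum.cong) (auto simp: indicator_def ennreal_less_iff)
    also have "\<dots> = ennreal (\<Sum>n<N. if t * 2 ^ n < z then (t * 2 ^ n) powr p else 0)"
      by (intro sum_ennreal) auto
    also have "\<dots> \<le> ennreal (2 powr p / (2 powr p - 1) * z powr p)"
      using real assms by (intro ennreal_leI geometric_sum_below) auto
    also have "\<dots> = ennreal (2 powr p / (2 powr p - 1)) * enn_powr y p"
      using real q by (simp add: enn_powr_ennreal flip: ennreal_mult)
    finally show ?thesis .
  next
    case top
    then show ?thesis
      using c by (simp add: ennreal_mult_top c_def[symmetric])
  qed
qed

text \<open>
  A finite family of functions whose averages are neither \<open>0\<close> nor \<open>\<infinity>\<close>, so that \<open>G\<close> below takes
  values in a bounded range and is bounded away from \<open>0\<close> on each cube.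
\<close>

locale cube_family = concave_averaging p A \<nu>
  for p A :: real and \<nu> :: "(real ^ 'n) measure" +
  fixes D :: real and K :: "'k set"
    and Q :: "'k \<Rightarrow> (real ^ 'n) set" and g :: "'k \<Rightarrow> real ^ 'n \<Rightarrow> ennreal"
  assumes D: "0 < D" "0 < r \<Longrightarrow> emeasure \<nu> (cube c (3 * r)) \<le> ennreal D * emeasure \<nu> (cube c r)"
    and finite_K: "finite K"
    and cube_Q: "k \<in> K \<Longrightarrow> is_cube (Q k)"
    and g_measurable: "k \<in> K \<Longrightarrow> g k \<in> borel_measurable lebesgue"
    and g_support: "k \<in> K \<Longrightarrow> x \<notin> Q k \<Longrightarrow> g k x = 0"
    and average_pos: "k \<in> K \<Longrightarrow> 0 < average (Q k) (g k)"
    and average_finite: "k \<in> K \<Longrightarrow> average (Q k) (g k) < \<infinity>"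
begin

definition G :: "real ^ 'n \<Rightarrow> ennreal"
  where "G x = (\<Sum>k\<in>K. average (Q k) (g k) * indicator (Q k) x)"

definition level_const :: real
  where "level_const = 2 * A * D * (2 / eps) powr p"

lemma level_const_pos: "0 < level_const"
  using A D eps by (simp add: level_const_def)

lemma G_measurable [measurable]: "G \<in> borel_measurable lebesgue"
proof -
  have "(\<lambda>x. average (Q k) (g k) * indicator (Q k) x) \<in> borel_measurable lebesgue"
    if "k \<in> K" for k
    using is_cube_sets[OF cube_Q[OF that]] by measurable
  then show ?thesis
    unfolding G_def by (intro borel_measurable_sum) auto
qed

lemma sum_g_measurable: "J \<subseteq> K \<Longrightarrow> (\<lambda>x. \<Sum>k\<in>J. g k x) \<in> borel_measurable lebesgue"
  by (intro borel_measurable_sum) (use g_measurable in auto)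

text \<open>
  On a portion \<open>eps\<close> of each \<open>Q k\<close> the function \<open>G\<close> is at most \<open>t\<close>.  Since \<open>g k\<close> has the same mass as its
  average spread over \<open>Q k\<close>, restricting that average to the portion loses only the factor \<open>eps\<close>; and
  there the averages sum to at most \<open>G \<le> t\<close>.
\<close>

lemma average_sum_le:
  assumes R: "is_cube R" and J: "J \<subseteq> K" "\<And>k. k \<in> J \<Longrightarrow> Q k \<subseteq> R" and t: "0 \<le> t"
    and low: "\<And>k. k \<in> J \<Longrightarrow>
      ennreal eps * emeasure lebesgue (Q k) \<le> emeasure lebesgue (Q k \<inter> {x. G x \<le> ennreal t})"
  shows "average R (\<lambda>x. \<Sum>k\<in>J. g k x) \<le> ennreal (t / eps)"
proof -
  define L where "L = {x. G x \<le> ennreal t}"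
  have L [measurable]: "L \<in> sets lebesgue"
    using measurable_sets[OF G_measurable, of "{..ennreal t}"] by (simp add: L_def vimage_def)
  have QL: "Q k \<inter> L \<in> sets lebesgue" if "k \<in> J" for k
    using J that cube_Q by (intro sets.Int L is_cube_sets) auto
  obtain v where v: "0 < v" "emeasure lebesgue R = ennreal v"
    using emeasure_is_cube[OF R] .
  let ?a = "\<lambda>k. average (Q k) (g k)" and ?X = "average R (\<lambda>x. \<Sum>k\<in>J. g k x)"
  have "?X * emeasure lebesgue R = (\<integral>\<^sup>+x\<in>R. (\<Sum>k\<in>J. g k x) \<partial>lebesgue)"
    by (rule average_mult_emeasure[OF R])
  also have "\<dots> = (\<integral>\<^sup>+x. (\<Sum>k\<in>J. g k x * indicator (Q k) x) \<partial>lebesgue)"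
    unfolding sum_distrib_right using J g_support
    by (intro nn_integral_cong sum.cong) (auto simp: indicator_def)
  also have "\<dots> = (\<Sum>k\<in>J. (\<integral>\<^sup>+x\<in>Q k. g k x \<partial>lebesgue))"
    using J cube_Q g_measurable
    by (intro nn_integral_sum borel_measurable_times_ennreal borel_measurable_indicator) auto
  also have "\<dots> = (\<Sum>k\<in>J. ?a k * emeasure lebesgue (Q k))"
    using J cube_Q by (intro sum.cong) (auto simp: average_mult_emeasure)
  finally have "ennreal eps * (?X * emeasure lebesgue R)
      = (\<Sum>k\<in>J. ?a k * (ennreal eps * emeasure lebesgue (Q k)))"
    by (simp add: sum_distrib_left mult_ac)
  also have "\<dots> \<le> (\<Sum>k\<in>J. ?a k * emeasure lebesgue (Q k \<inter> L))"
    using low by (intro sum_mono mult_left_mono) (auto simp: L_def)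
  also have "\<dots> = (\<Sum>k\<in>J. (\<integral>\<^sup>+x. ?a k * indicator (Q k \<inter> L) x \<partial>lebesgue))"
    using QL by (intro sum.cong) (auto simp: nn_integral_cmult_indicator)
  also have "\<dots> = (\<integral>\<^sup>+x. (\<Sum>k\<in>J. ?a k * indicator (Q k \<inter> L) x) \<partial>lebesgue)"
    using QL by (intro nn_integral_sum[symmetric]) auto
  also have "\<dots> \<le> (\<integral>\<^sup>+x. ennreal t * indicator R x \<partial>lebesgue)"
  proof (intro nn_integral_mono)
    fix x
    show "(\<Sum>k\<in>J. ?a k * indicator (Q k \<inter> L) x) \<le> ennreal t * indicator R x"
    proof (cases "x \<in> R \<inter> L")
      case True
      have "(\<Sum>k\<in>J. ?a k * indicator (Q k \<inter> L) x) \<le> G x"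
        unfolding G_def using J finite_K True
        by (intro order_trans[OF sum_mono sum_mono2]) (auto simp: indicator_def)
      also have "\<dots> \<le> ennreal t"
        using True by (simp add: L_def)
      finally show ?thesis
        using True by simp
    next
      case False
      then have "(\<Sum>k\<in>J. ?a k * indicator (Q k \<inter> L) x) = 0"
        using J by (intro sum.neutral) (auto simp: indicator_def)
      then show ?thesis
        by simp
    qed
  qed
  also have "\<dots> = ennreal t * emeasure lebesgue R"
    using R by (simp add: nn_integral_cmult_indicator)
  finally have *: "ennreal eps * (?X * ennreal v) \<le> ennreal t * ennreal v"
    by (simp add: v)
  show ?thesis
  proof (cases ?X)
    case (real z)
    then have "ennreal (eps * (z * v)) \<le> ennreal (t * v)"
      using * eps v t by (simp add: ennreal_mult)
    then have "eps * z * v \<le> t * v"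
      using t v by (simp add: mult_ac)
    then have "z \<le> t / eps"
      using v eps by (simp add: field_simps)
    then show ?thesis
      using real by (simp add: ennreal_leI)
  next
    case top
    then show ?thesis
      using * v eps t
      by (simp add: ennreal_mult_top ennreal_top_mult top_unique flip: ennreal_mult)
  qed
qed

text \<open>
  The cubes inside the triple of one cube \<open>S\<close> are treated as a single function on the triple, to which
  \<open>concave_mean\<close> applies.  Doubling returns from the triple to \<open>S\<close>, and the density condition \<open>high\<close>
  returns from \<open>S\<close> to its part in the level set.
\<close>

lemma cluster_estimate:
  assumes r: "0 < r" and J: "J \<subseteq> K" "\<And>k. k \<in> J \<Longrightarrow> Q k \<subseteq> cube c (3 * r)" and t: "0 < t"
    and low: "\<And>k. k \<in> J \<Longrightarrow>
      ennreal eps * emeasure lebesgue (Q k) \<le> emeasure lebesgue (Q k \<inter> {x. G x \<le> ennreal (2 * t)})"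
    and high: "emeasure lebesgue (cube c r - {x. ennreal t < G x})
      \<le> ennreal eps * emeasure lebesgue (cube c r)"
  shows "(\<integral>\<^sup>+x. enn_powr (\<Sum>k\<in>J. g k x) p \<partial>\<nu>)
    \<le> ennreal (level_const * t powr p) * emeasure \<nu> (cube c r \<inter> {x. ennreal t < G x})"
proof -
  let ?R = "cube c (3 * r)" and ?H = "{x. ennreal t < G x}" and ?f = "\<lambda>x. \<Sum>k\<in>J. g k x"
  have R: "is_cube ?R"
    using r by (simp add: is_cube_cube)
  have H: "?H \<in> sets lebesgue"
    using measurable_sets[OF G_measurable, of "{ennreal t<..}"] by (simp add: vimage_def)
  have "(\<integral>\<^sup>+x. enn_powr (?f x) p \<partial>\<nu>) = (\<integral>\<^sup>+x\<in>?R. enn_powr (?f x) p \<partial>\<nu>)"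
  proof (intro nn_integral_cong)
    fix x
    have "?f x = 0" if "x \<notin> ?R"
      using that J g_support by (intro sum.neutral) blast
    then show "enn_powr (?f x) p = enn_powr (?f x) p * indicator ?R x"
      by (auto simp: indicator_def)
  qed
  also have "\<dots> \<le> ennreal A * enn_powr (average ?R ?f) p * emeasure \<nu> ?R"
    by (intro concave_mean R sum_g_measurable J)
  also have "\<dots> \<le> ennreal A * enn_powr (ennreal (2 * t / eps)) p
      * (ennreal D * (2 * emeasure \<nu> (cube c r \<inter> ?H)))"
  proof (intro mult_mono enn_powr_mono order_refl p)
    show "average ?R ?f \<le> ennreal (2 * t / eps)"
      by (rule average_sum_le[OF R]) (use J t low in auto)
    have "emeasure \<nu> ?R \<le> ennreal D * emeasure \<nu> (cube c r)"
      by (rule D(2)[OF r])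
    also have "\<dots> \<le> ennreal D * (2 * emeasure \<nu> (cube c r \<inter> ?H))"
      by (intro mult_left_mono measure_most_of_cube is_cube_cube r H high) simp
    finally show "emeasure \<nu> ?R \<le> \<dots>" .
  qed auto
  also have "\<dots> = ennreal (A * (2 * t / eps) powr p * (D * 2)) * emeasure \<nu> (cube c r \<inter> ?H)"
    using A D eps t by (simp add: enn_powr_ennreal ennreal_mult mult_ac)
  also have "A * (2 * t / eps) powr p * (D * 2) = level_const * t powr p"
    using eps t by (simp add: level_const_def powr_mult powr_divide)
  finally show ?thesis .
qed

text \<open>
  A greedy Vitali selection carried out by induction on the family: the largest cube \<open>Q m\<close> absorbs all
  cubes meeting it into one cluster.  The remaining cubes are disjoint from \<open>Q m\<close>, so the bounds for
  the cluster and for the remainder involve disjoint parts of the level set and can be added.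
\<close>

lemma level_estimate:
  assumes t: "0 < t" and J: "J \<subseteq> K"
    and low: "\<And>k. k \<in> J \<Longrightarrow>
      ennreal eps * emeasure lebesgue (Q k) \<le> emeasure lebesgue (Q k \<inter> {x. G x \<le> ennreal (2 * t)})"
    and high: "\<And>k. k \<in> J \<Longrightarrow> emeasure lebesgue (Q k - {x. ennreal t < G x})
      \<le> ennreal eps * emeasure lebesgue (Q k)"
  shows "(\<integral>\<^sup>+x. enn_powr (\<Sum>k\<in>J. g k x) p \<partial>\<nu>)
    \<le> ennreal (level_const * t powr p) * emeasure \<nu> (\<Union>(Q ` J) \<inter> {x. ennreal t < G x})"
proof -
  let ?H = "{x. ennreal t < G x}"
  have H: "?H \<in> sets lebesgue"
    using measurable_sets[OF G_measurable, of "{ennreal t<..}"] by (simp add: vimage_def)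
  have "\<exists>c r. \<forall>k\<in>K. 0 < r k \<and> Q k = cube (c k) (r k)"
    using cube_Q unfolding is_cube_iff by metis
  then obtain c r where cr: "\<And>k. k \<in> K \<Longrightarrow> 0 < r k" "\<And>k. k \<in> K \<Longrightarrow> Q k = cube (c k) (r k)"
    by metis
  have "finite J"
    using J finite_K finite_subset by blast
  then show ?thesis
    using J low high
  proof (induction J rule: finite_psubset_induct)
    case (psubset J)
    show ?case
    proof (cases "J = {}")
      case False
      have "Max (r ` J) \<in> r ` J"
        using False psubset.hyps by simp
      then obtain m where "m \<in> J" "r m = Max (r ` J)"
        by auto
      with psubset.hyps have m: "m \<in> J" "\<And>k. k \<in> J \<Longrightarrow> r k \<le> r m"
        by auto
      define J1 where "J1 = {k \<in> J. Q k \<inter> Q m \<noteq> {}}"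
      have Qm: "Q m = cube (c m) (r m)" "0 < r m"
        using cr m psubset.prems by auto
      have "c m \<in> Q m"
        using Qm by (simp add: mem_cube)
      with m have "m \<in> J1"
        by (auto simp: J1_def)
      have cluster: "(\<integral>\<^sup>+x. enn_powr (\<Sum>k\<in>J1. g k x) p \<partial>\<nu>)
          \<le> ennreal (level_const * t powr p) * emeasure \<nu> (Q m \<inter> ?H)"
        unfolding Qm(1)
      proof (rule cluster_estimate)
        show "Q k \<subseteq> cube (c m) (3 * r m)" if "k \<in> J1" for k
          using that m cr(2)[of k] Qm psubset.prems(1) cube_subset_triple[of "c k" "r k" "c m" "r m"]
          by (auto simp: J1_def)
        show "emeasure lebesgue (cube (c m) (r m) - ?H)
            \<le> ennreal eps * emeasure lebesgue (cube (c m) (r m))"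
          using psubset.prems(3)[OF m(1)] by (simp add: Qm)
      qed (use Qm psubset.prems t in \<open>auto simp: J1_def\<close>)
      have rest: "(\<integral>\<^sup>+x. enn_powr (\<Sum>k\<in>J - J1. g k x) p \<partial>\<nu>)
          \<le> ennreal (level_const * t powr p) * emeasure \<nu> (\<Union>(Q ` (J - J1)) \<inter> ?H)"
        by (rule psubset.IH) (use \<open>m \<in> J1\<close> m psubset.prems in auto)
      have meas: "J' \<subseteq> J \<Longrightarrow> (\<lambda>x. enn_powr (\<Sum>k\<in>J'. g k x) p) \<in> borel_measurable \<nu>" for J'
        using sum_g_measurable[of J'] psubset.prems(1) by (simp add: measurable_cong_sets[OF sets_nu refl])
      have setsQ: "Q m \<inter> ?H \<in> sets \<nu>" "\<Union>(Q ` (J - J1)) \<inter> ?H \<in> sets \<nu>"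
        using H psubset.hyps m psubset.prems(1) cube_Q unfolding sets_nu
        by (auto intro!: sets.Int sets.finite_UN)
      have "(\<integral>\<^sup>+x. enn_powr (\<Sum>k\<in>J. g k x) p \<partial>\<nu>)
          \<le> (\<integral>\<^sup>+x. enn_powr (\<Sum>k\<in>J1. g k x) p + enn_powr (\<Sum>k\<in>J - J1. g k x) p \<partial>\<nu>)"
      proof (intro nn_integral_mono)
        fix x
        have "(\<Sum>k\<in>J. g k x) = (\<Sum>k\<in>J1. g k x) + (\<Sum>k\<in>J - J1. g k x)"
          using psubset.hyps by (subst sum.subset_diff[of J1]) (auto simp: J1_def add.commute)
        then show "enn_powr (\<Sum>k\<in>J. g k x) p
            \<le> enn_powr (\<Sum>k\<in>J1. g k x) p + enn_powr (\<Sum>k\<in>J - J1. g k x) p"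
          using enn_powr_add_le[OF p] by simp
      qed
      also have "\<dots> = (\<integral>\<^sup>+x. enn_powr (\<Sum>k\<in>J1. g k x) p \<partial>\<nu>)
          + (\<integral>\<^sup>+x. enn_powr (\<Sum>k\<in>J - J1. g k x) p \<partial>\<nu>)"
        by (intro nn_integral_add meas) (auto simp: J1_def)
      also have "\<dots> \<le> ennreal (level_const * t powr p) * emeasure \<nu> (Q m \<inter> ?H)
          + ennreal (level_const * t powr p) * emeasure \<nu> (\<Union>(Q ` (J - J1)) \<inter> ?H)"
        by (intro add_mono cluster rest)
      also have "\<dots> = ennreal (level_const * t powr p)
          * emeasure \<nu> ((Q m \<inter> ?H) \<union> (\<Union>(Q ` (J - J1)) \<inter> ?H))"
        using setsQ by (subst plus_emeasure[symmetric]) (auto simp: J1_def distrib_left)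
      also have "\<dots> \<le> ennreal (level_const * t powr p) * emeasure \<nu> (\<Union>(Q ` J) \<inter> ?H)"
        using H psubset.hyps m psubset.prems(1) cube_Q
        by (intro mult_left_mono emeasure_mono) (auto simp: sets_nu intro!: sets.Int sets.finite_UN)
      finally show ?thesis .
    qed simp
  qed
qed

text \<open>
  The level of \<open>Q k\<close> is, up to a factor \<open>2\<close>, the \<open>eps\<close>-quantile of \<open>G\<close> on \<open>Q k\<close>.  The least \<open>n\<close> for
  which \<open>{G \<le> t * 2 ^ n}\<close> fills the portion \<open>eps\<close> of \<open>Q k\<close> is not \<open>0\<close>, because \<open>G\<close> exceeds \<open>t\<close> on the whole
  of \<open>Q k\<close>; its predecessor is the level.
\<close>

lemma exists_level:
  assumes k: "k \<in> K" and t: "0 < t" "ennreal t < average (Q k) (g k)"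
    and N: "\<And>x. G x \<le> ennreal (t * 2 ^ N)"
  shows "\<exists>n<N. ennreal eps * emeasure lebesgue (Q k)
        \<le> emeasure lebesgue (Q k \<inter> {x. G x \<le> ennreal (2 * (t * 2 ^ n))}) \<and>
      emeasure lebesgue (Q k - {x. ennreal (t * 2 ^ n) < G x}) \<le> ennreal eps * emeasure lebesgue (Q k)"
proof -
  obtain v where v: "0 < v" "emeasure lebesgue (Q k) = ennreal v"
    using emeasure_is_cube[OF cube_Q[OF k]] .
  define P where "P n \<longleftrightarrow> ennreal eps * emeasure lebesgue (Q k)
    \<le> emeasure lebesgue (Q k \<inter> {x. G x \<le> ennreal (t * 2 ^ n)})" for n
  have "Q k \<inter> {x. G x \<le> ennreal (t * 2 ^ N)} = Q k"
    using N by auto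
  then have "P N"
    using v eps by (simp add: P_def ennreal_leI flip: ennreal_mult)
  have "average (Q k) (g k) \<le> G x" if "x \<in> Q k" for x
    unfolding G_def using that k finite_K
    by (intro order_trans[OF _ member_le_sum[of k K]]) auto
  then have "Q k \<inter> {x. G x \<le> ennreal (t * 2 ^ 0)} = {}"
    using t(2) by force
  then have "\<not> P 0"
    using v eps by (simp add: P_def flip: ennreal_mult)
  then obtain n where n: "n < N" "\<not> P n" "P (Suc n)"
    using ex_least_nat_less[of P N] \<open>P N\<close> by auto
  have "Q k - {x. ennreal (t * 2 ^ n) < G x} = Q k \<inter> {x. G x \<le> ennreal (t * 2 ^ n)}"
    by auto
  with n show ?thesis
    by (intro exI[of _ n]) (auto simp: P_def mult_ac)
qed

text \<open>
  Subadditivity of \<open>y \<mapsto> y powr p\<close> separates the levels.  The level estimates then add up to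
  \<open>\<Sum>n. (t * 2 ^ n) powr p * \<nu> {x. t * 2 ^ n < G x}\<close>, a discrete layer-cake expression for the integral
  of \<open>G powr p\<close>.
\<close>

lemma finite_sum_estimate:
  "(\<integral>\<^sup>+x. enn_powr (\<Sum>k\<in>K. g k x) p \<partial>\<nu>)
    \<le> ennreal (level_const * (2 powr p / (2 powr p - 1))) * (\<integral>\<^sup>+x. enn_powr (G x) p \<partial>\<nu>)"
proof (cases "K = {}")
  case False
  let ?a = "\<lambda>k. average (Q k) (g k)"
  have q: "1 < 2 powr p"
    using p powr_less_mono[of 0 p 2] by simp
  \<comment> \<open>The lowest level \<open>t\<close> is below every average, hence below \<open>G\<close> on every cube of the family, and the
    level \<open>t * 2 ^ N\<close> bounds \<open>G\<close> everywhere; so finitely many levels suffice.\<close>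
  have "0 < Min (?a ` K)"
    using False finite_K average_pos by simp
  then obtain t where t: "0 < t" "ennreal t < Min (?a ` K)"
    using dense[of 0 "Min (?a ` K)"] by (metis ennreal_cases ennreal_less_zero_iff not_top_less)
  then have t_less: "ennreal t < ?a k" if "k \<in> K" for k
    using that finite_K False by simp
  have "(\<Sum>k\<in>K. ?a k) \<noteq> top"
    using average_finite finite_K by (simp add: less_top)
  then obtain s where s: "(\<Sum>k\<in>K. ?a k) = ennreal s"
    by (cases "\<Sum>k\<in>K. ?a k") auto
  obtain N where N: "s / t < 2 ^ N"
    using real_arch_pow[of 2 "s / t"] by auto
  have G_le: "G x \<le> ennreal (t * 2 ^ N)" for x
  proof -
    have "G x \<le> (\<Sum>k\<in>K. ?a k)"
      unfolding G_def by (intro sum_mono) (auto simp: indicator_def)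
    also have "\<dots> \<le> ennreal (t * 2 ^ N)"
      using N t by (simp add: s field_simps ennreal_leI)
    finally show ?thesis .
  qed
  define H where "H n = {x. ennreal (t * 2 ^ n) < G x}" for n :: nat
  have H: "H n \<in> sets \<nu>" for n
    using measurable_sets[OF G_measurable, of "{ennreal (t * 2 ^ n)<..}"]
    by (simp add: vimage_def H_def sets_nu)
  have "\<exists>lev. \<forall>k\<in>K. lev k < N \<and>
      ennreal eps * emeasure lebesgue (Q k)
        \<le> emeasure lebesgue (Q k \<inter> {x. G x \<le> ennreal (2 * (t * 2 ^ lev k))}) \<and>
      emeasure lebesgue (Q k - H (lev k)) \<le> ennreal eps * emeasure lebesgue (Q k)"
    unfolding H_def by (intro bchoice ballI exists_level t t_less G_le)
  then obtain lev where lev: "\<And>k. k \<in> K \<Longrightarrow> lev k < N"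
    "\<And>k. k \<in> K \<Longrightarrow> ennreal eps * emeasure lebesgue (Q k)
        \<le> emeasure lebesgue (Q k \<inter> {x. G x \<le> ennreal (2 * (t * 2 ^ lev k))})"
    "\<And>k. k \<in> K \<Longrightarrow> emeasure lebesgue (Q k - H (lev k)) \<le> ennreal eps * emeasure lebesgue (Q k)"
    by blast
  define L where "L n = {k \<in> K. lev k = n}" for n
  have L: "L n \<subseteq> K" for n
    by (auto simp: L_def)
  have meas: "(\<lambda>x. enn_powr (\<Sum>k\<in>L n. g k x) p) \<in> borel_measurable \<nu>" for n
    using sum_g_measurable[OF L] by (simp add: measurable_cong_sets[OF sets_nu refl])
  have measG: "(\<lambda>x. enn_powr (G x) p) \<in> borel_measurable \<nu>"
    using G_measurable by (simp add: measurable_cong_sets[OF sets_nu refl])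
  have "(\<integral>\<^sup>+x. enn_powr (\<Sum>k\<in>K. g k x) p \<partial>\<nu>)
      \<le> (\<integral>\<^sup>+x. (\<Sum>n<N. enn_powr (\<Sum>k\<in>L n. g k x) p) \<partial>\<nu>)"
  proof (intro nn_integral_mono)
    fix x
    have "(\<Sum>k\<in>K. g k x) = (\<Sum>n<N. \<Sum>k\<in>L n. g k x)"
      unfolding L_def using finite_K lev by (intro sum.group[symmetric]) auto
    then show "enn_powr (\<Sum>k\<in>K. g k x) p \<le> (\<Sum>n<N. enn_powr (\<Sum>k\<in>L n. g k x) p)"
      by (simp add: enn_powr_sum_le[OF p])
  qed
  also have "\<dots> = (\<Sum>n<N. \<integral>\<^sup>+x. enn_powr (\<Sum>k\<in>L n. g k x) p \<partial>\<nu>)"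
    by (intro nn_integral_sum meas)
  also have "\<dots> \<le> (\<Sum>n<N. ennreal (level_const * (t * 2 ^ n) powr p) * emeasure \<nu> (H n))"
  proof (intro sum_mono)
    fix n
    have "(\<integral>\<^sup>+x. enn_powr (\<Sum>k\<in>L n. g k x) p \<partial>\<nu>)
        \<le> ennreal (level_const * (t * 2 ^ n) powr p) * emeasure \<nu> (\<Union>(Q ` L n) \<inter> H n)"
      unfolding H_def using t lev L by (intro level_estimate) (auto simp: L_def H_def)
    also have "\<dots> \<le> ennreal (level_const * (t * 2 ^ n) powr p) * emeasure \<nu> (H n)"
      by (intro mult_left_mono emeasure_mono H) auto
    finally show "(\<integral>\<^sup>+x. enn_powr (\<Sum>k\<in>L n. g k x) p \<partial>\<nu>) \<le> \<dots>" .
  qed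
  also have "\<dots> = (\<Sum>n<N. \<integral>\<^sup>+x. ennreal level_const * (ennreal ((t * 2 ^ n) powr p) * indicator (H n) x) \<partial>\<nu>)"
    using level_const_pos H
    by (intro sum.cong) (auto simp: ennreal_mult mult.assoc nn_integral_cmult nn_integral_cmult_indicator)
  also have "\<dots> = (\<integral>\<^sup>+x. (\<Sum>n<N. ennreal level_const * (ennreal ((t * 2 ^ n) powr p) * indicator (H n) x)) \<partial>\<nu>)"
    using H by (intro nn_integral_sum[symmetric]) auto
  also have "\<dots> \<le> (\<integral>\<^sup>+x. ennreal level_const * (ennreal (2 powr p / (2 powr p - 1)) * enn_powr (G x) p) \<partial>\<nu>)"
  proof (intro nn_integral_mono)
    fix x
    have "(\<Sum>n<N. ennreal ((t * 2 ^ n) powr p) * indicator (H n) x)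
        = (\<Sum>n<N. ennreal ((t * 2 ^ n) powr p) * indicator {z. ennreal (t * 2 ^ n) < z} (G x))"
      by (simp add: H_def indicator_def)
    also have "\<dots> \<le> ennreal (2 powr p / (2 powr p - 1)) * enn_powr (G x) p"
      by (rule geometric_sum_below_ennreal[OF p(1) t(1)])
    finally show "(\<Sum>n<N. ennreal level_const * (ennreal ((t * 2 ^ n) powr p) * indicator (H n) x))
        \<le> ennreal level_const * (ennreal (2 powr p / (2 powr p - 1)) * enn_powr (G x) p)"
      by (simp add: mult_left_mono flip: sum_distrib_left)
  qed
  also have "\<dots> = ennreal (level_const * (2 powr p / (2 powr p - 1))) * (\<integral>\<^sup>+x. enn_powr (G x) p \<partial>\<nu>)"
    using level_const_pos q measG by (subst ennreal_mult) (auto simp: nn_integral_cmult mult.assoc)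
  finally show ?thesis .
qed simp

end

section \<open>Sequences of cubes\<close>

context concave_averaging
begin

text \<open>
  The passage from finite families to sequences is monotone convergence.  Functions with average \<open>0\<close> or
  \<open>\<infinity>\<close> can be discarded first: by \<open>concave_mean\<close> the integral of \<open>enn_powr (g k x) p\<close> vanishes, in the
  case of \<open>\<infinity>\<close> because finiteness of the right-hand side forces \<open>\<nu> (Q k) = 0\<close>.
\<close>

lemma sum_estimate:
  obtains C where "0 < C"
    "\<And>(Q :: nat \<Rightarrow> (real ^ 'n) set) g. (\<And>k. is_cube (Q k)) \<Longrightarrow>
      (\<And>k. g k \<in> borel_measurable lebesgue) \<Longrightarrow> (\<And>k. support_on UNIV (g k) \<subseteq> Q k) \<Longrightarrow>
      (\<integral>\<^sup>+x. enn_powr (\<Sum>k. g k x) p \<partial>\<nu>)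
        \<le> ennreal C * (\<integral>\<^sup>+x. enn_powr (\<Sum>k. average (Q k) (g k) * indicator (Q k) x) p \<partial>\<nu>)"
proof -
  obtain D where D: "0 < D"
    "\<And>c r. 0 < r \<Longrightarrow> emeasure \<nu> (cube c (3 * r)) \<le> ennreal D * emeasure \<nu> (cube c r)"
    using doubling by blast
  define C where "C = 2 * A * D * (2 / eps) powr p * (2 powr p / (2 powr p - 1))"
  have "1 < 2 powr p"
    using p powr_less_mono[of 0 p 2] by simp
  then have C: "0 < C"
    using A D eps by (simp add: C_def)
  show ?thesis
  proof (rule that[OF C])
    fix Q :: "nat \<Rightarrow> (real ^ 'n) set" and g :: "nat \<Rightarrow> real ^ 'n \<Rightarrow> ennreal"
    assume Q: "\<And>k. is_cube (Q k)" and g: "\<And>k. g k \<in> borel_measurable lebesgue"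
      and supp: "\<And>k. support_on UNIV (g k) \<subseteq> Q k"
    let ?a = "\<lambda>k. average (Q k) (g k)" and ?G = "\<lambda>x. \<Sum>k. average (Q k) (g k) * indicator (Q k) x"
    have g0: "g k x = 0" if "x \<notin> Q k" for k x
      using supp[of k] that by (auto simp: support_on_def)
    have g_nu [measurable]: "g k \<in> borel_measurable \<nu>" for k
      using g by (simp add: measurable_cong_sets[OF sets_nu refl])
    have Q_nu [measurable]: "Q k \<in> sets \<nu>" for k
      using Q by (simp add: sets_nu)
    have G_ge: "(\<Sum>k\<in>K. ?a k * indicator (Q k) x) \<le> ?G x" if "finite K" for K x
      using that by (intro sum_le_suminf) auto
    show "(\<integral>\<^sup>+x. enn_powr (\<Sum>k. g k x) p \<partial>\<nu>) \<le> ennreal C * (\<integral>\<^sup>+x. enn_powr (?G x) p \<partial>\<nu>)"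
    proof (cases "(\<integral>\<^sup>+x. enn_powr (?G x) p \<partial>\<nu>) = \<infinity>")
      case True
      then show ?thesis
        using C by (simp add: ennreal_mult_top)
    next
      case fin: False
      have bad: "(\<integral>\<^sup>+x. enn_powr (g k x) p \<partial>\<nu>) = 0" if "?a k = 0 \<or> ?a k = \<infinity>" for k
      proof -
        have "?a k = \<infinity> \<Longrightarrow> emeasure \<nu> (Q k) = 0"
        proof -
          assume a: "?a k = \<infinity>"
          have "\<infinity> * emeasure \<nu> (Q k) = (\<integral>\<^sup>+x. \<infinity> * indicator (Q k) x \<partial>\<nu>)"
            by (simp add: nn_integral_cmult_indicator)
          also have "\<dots> \<le> (\<integral>\<^sup>+x. enn_powr (?G x) p \<partial>\<nu>)"
          proof (intro nn_integral_mono)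
            fix x
            show "\<infinity> * indicator (Q k) x \<le> enn_powr (?G x) p"
              using G_ge[of "{k}" x] a by (auto simp: indicator_def top_unique)
          qed
          finally show "emeasure \<nu> (Q k) = 0"
            using fin by (auto simp: ennreal_top_mult top_unique split: if_splits)
        qed
        then have null: "ennreal A * enn_powr (?a k) p * emeasure \<nu> (Q k) = 0"
          using that by auto
        have "(\<integral>\<^sup>+x\<in>Q k. enn_powr (g k x) p \<partial>\<nu>) = 0"
          using concave_mean[OF Q g, of k k] unfolding null by simp
        moreover have "enn_powr (g k x) p = enn_powr (g k x) p * indicator (Q k) x" for x
          using g0[of x k] by (auto simp: indicator_def)
        ultimately show ?thesis
          by simp
      qed
      have partial: "(\<integral>\<^sup>+x. enn_powr (\<Sum>k<N. g k x) p \<partial>\<nu>)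
          \<le> ennreal C * (\<integral>\<^sup>+x. enn_powr (?G x) p \<partial>\<nu>)" for N
      proof -
        define K where "K = {k. k < N \<and> 0 < ?a k \<and> ?a k < \<infinity>}"
        have K: "K \<subseteq> {..<N}"
          by (auto simp: K_def)
        then have "finite K"
          using finite_subset by blast
        interpret cube_family p A \<nu> D K Q g
          by unfold_locales (use D Q g g0 \<open>finite K\<close> in \<open>auto simp: K_def\<close>)
        have "(\<integral>\<^sup>+x. enn_powr (\<Sum>k<N. g k x) p \<partial>\<nu>)
            \<le> (\<integral>\<^sup>+x. enn_powr (\<Sum>k\<in>K. g k x) p + (\<Sum>k\<in>{..<N} - K. enn_powr (g k x) p) \<partial>\<nu>)"
        proof (intro nn_integral_mono)
          fix x
          have "(\<Sum>k<N. g k x) = (\<Sum>k\<in>K. g k x) + (\<Sum>k\<in>{..<N} - K. g k x)"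
            by (subst sum.subset_diff[OF K]) (auto simp: add.commute)
          then have "enn_powr (\<Sum>k<N. g k x) p
              \<le> enn_powr (\<Sum>k\<in>K. g k x) p + enn_powr (\<Sum>k\<in>{..<N} - K. g k x) p"
            using enn_powr_add_le[OF p] by simp
          also have "\<dots> \<le> enn_powr (\<Sum>k\<in>K. g k x) p + (\<Sum>k\<in>{..<N} - K. enn_powr (g k x) p)"
            by (intro add_left_mono enn_powr_sum_le p) auto
          finally show "enn_powr (\<Sum>k<N. g k x) p \<le> \<dots>" .
        qed
        also have "\<dots> = (\<integral>\<^sup>+x. enn_powr (\<Sum>k\<in>K. g k x) p \<partial>\<nu>)
            + (\<Sum>k\<in>{..<N} - K. \<integral>\<^sup>+x. enn_powr (g k x) p \<partial>\<nu>)"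
          by (simp add: nn_integral_add nn_integral_sum)
        also have "(\<Sum>k\<in>{..<N} - K. \<integral>\<^sup>+x. enn_powr (g k x) p \<partial>\<nu>) = 0"
          using bad by (intro sum.neutral) (force simp: K_def less_top zero_less_iff_neq_zero)
        also have "(\<integral>\<^sup>+x. enn_powr (\<Sum>k\<in>K. g k x) p \<partial>\<nu>) + 0
            \<le> ennreal C * (\<integral>\<^sup>+x. enn_powr (G x) p \<partial>\<nu>)"
          using finite_sum_estimate by (simp add: level_const_def C_def)
        also have "\<dots> \<le> ennreal C * (\<integral>\<^sup>+x. enn_powr (?G x) p \<partial>\<nu>)"
          unfolding G_def using \<open>finite K\<close>
          by (intro mult_left_mono nn_integral_mono enn_powr_mono p G_ge) auto
        finally show ?thesis .
      qed
      have "(\<integral>\<^sup>+x. enn_powr (\<Sum>k. g k x) p \<partial>\<nu>)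
          \<le> (\<integral>\<^sup>+x. (SUP N. enn_powr (\<Sum>k<N. g k x) p) \<partial>\<nu>)"
        unfolding suminf_eq_SUP by (intro nn_integral_mono enn_powr_SUP_le p)
      also have "\<dots> = (SUP N. \<integral>\<^sup>+x. enn_powr (\<Sum>k<N. g k x) p \<partial>\<nu>)"
        using p
        by (intro nn_integral_monotone_convergence_SUP)
          (auto simp: incseq_def le_fun_def intro!: enn_powr_mono sum_mono2)
      also have "\<dots> \<le> ennreal C * (\<integral>\<^sup>+x. enn_powr (?G x) p \<partial>\<nu>)"
        by (intro SUP_least partial)
      finally show ?thesis .
    qed
  qed
qed

end

section \<open>Weights in a reverse Hoelder class\<close>

text \<open>
  For \<open>p < 1\<close> the exponent \<open>(1/p)'\<close> is \<open>s = 1 / (1 - p)\<close> and \<open>w = (w\<^sup>s)\<^bsup>1 - p\<^esup>\<close>, so that Hoelder's inequality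
  bounds the left-hand side by the average of \<open>f\<close> to the power \<open>p\<close> and the \<open>s\<close>-mean of \<open>w\<close>; the latter is
  comparable to the plain average of \<open>w\<close>.  For \<open>p = 1\<close> the pointwise bound on \<open>w\<close> does the same.
\<close>

lemma concave_mean_le_of_reverse_Holder:
  fixes w :: "real ^ 'n \<Rightarrow> ennreal"
  assumes p: "0 < p" "p \<le> 1"
    and w [measurable]: "w \<in> borel_measurable lebesgue"
    and RH: "reverse_Holder (conj_exponent (ennreal (1 / p))) w"
  obtains A where "1 \<le> A"
    "\<And>Q f. is_cube Q \<Longrightarrow> f \<in> borel_measurable lebesgue \<Longrightarrow>
      (\<integral>\<^sup>+x\<in>Q. enn_powr (f x) p * w x \<partial>lebesgue)
        \<le> ennreal A * enn_powr (average Q f) p * (\<integral>\<^sup>+x\<in>Q. w x \<partial>lebesgue)"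
proof (cases "p = 1")
  case True
  then have "conj_exponent (ennreal (1 / p)) = \<infinity>"
    by (simp add: conj_exponent_1)
  then obtain C where C: "\<And>Q. is_cube Q \<Longrightarrow>
      AE x in lebesgue. x \<in> Q \<longrightarrow> w x \<le> ennreal C * average Q w"
    using RH by (auto simp: reverse_Holder_def)
  show ?thesis
  proof (rule that[of "max 1 C"])
    fix Q :: "(real ^ 'n) set" and f :: "real ^ 'n \<Rightarrow> ennreal"
    assume Q: "is_cube Q" and f [measurable]: "f \<in> borel_measurable lebesgue"
    have [measurable]: "Q \<in> sets lebesgue"
      using Q by simp
    have "(\<integral>\<^sup>+x\<in>Q. enn_powr (f x) p * w x \<partial>lebesgue)
        \<le> (\<integral>\<^sup>+x. f x * indicator Q x * (ennreal (max 1 C) * average Q w) \<partial>lebesgue)"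
    proof (intro nn_integral_mono_AE eventually_mono[OF C[OF Q]])
      fix x assume "x \<in> Q \<longrightarrow> w x \<le> ennreal C * average Q w"
      moreover have "ennreal C * average Q w \<le> ennreal (max 1 C) * average Q w"
        by (intro mult_right_mono ennreal_leI) auto
      ultimately show "enn_powr (f x) p * w x * indicator Q x
          \<le> f x * indicator Q x * (ennreal (max 1 C) * average Q w)"
        using True by (auto simp: indicator_def intro!: mult_left_mono)
    qed
    also have "\<dots> = (\<integral>\<^sup>+x\<in>Q. f x \<partial>lebesgue) * (ennreal (max 1 C) * average Q w)"
      by (simp add: nn_integral_multc)
    also have "\<dots> = ennreal (max 1 C) * average Q f * (average Q w * emeasure lebesgue Q)"
      unfolding average_mult_emeasure[OF Q, of f, symmetric] by (simp add: mult_ac)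
    finally show "(\<integral>\<^sup>+x\<in>Q. enn_powr (f x) p * w x \<partial>lebesgue)
        \<le> ennreal (max 1 C) * enn_powr (average Q f) p * (\<integral>\<^sup>+x\<in>Q. w x \<partial>lebesgue)"
      using True by (simp add: average_mult_emeasure[OF Q])
  qed simp
next
  case False
  with p have p1: "p < 1"
    by simp
  define s where "s = 1 / (1 - p)"
  have s: "0 < s" "1 / s = 1 - p"
    using p1 by (simp_all add: s_def)
  have "1 / p / (1 / p - 1) = s"
    using p p1 by (simp add: s_def field_simps)
  moreover have "1 < 1 / p"
    using p p1 by simp
  ultimately have "conj_exponent (ennreal (1 / p)) = ennreal s"
    by (simp add: conj_exponent_ennreal)
  then obtain C where C: "\<And>Q. is_cube Q \<Longrightarrow>
      enn_powr (average Q (\<lambda>x. enn_powr (w x) s)) (1 - p) \<le> ennreal C * average Q w"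
    using RH s by (auto simp: reverse_Holder_def)
  show ?thesis
  proof (rule that[of "max 1 C"])
    fix Q :: "(real ^ 'n) set" and f :: "real ^ 'n \<Rightarrow> ennreal"
    assume Q: "is_cube Q" and f [measurable]: "f \<in> borel_measurable lebesgue"
    have [measurable]: "Q \<in> sets lebesgue"
      using Q by simp
    obtain v where v: "0 < v" "emeasure lebesgue Q = ennreal v"
      using emeasure_is_cube[OF Q] .
    let ?W = "\<lambda>x. enn_powr (w x) s"
    have "(\<integral>\<^sup>+x\<in>Q. enn_powr (f x) p * w x \<partial>lebesgue)
        = (\<integral>\<^sup>+x. enn_powr (f x * indicator Q x) p * enn_powr (?W x * indicator Q x) (1 - p) \<partial>lebesgue)"
      using p p1 s
      by (intro nn_integral_cong) (auto simp: indicator_def enn_powr_enn_powr s_def)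
    also have "\<dots> \<le> enn_powr (\<integral>\<^sup>+x\<in>Q. f x \<partial>lebesgue) p * enn_powr (\<integral>\<^sup>+x\<in>Q. ?W x \<partial>lebesgue) (1 - p)"
      by (intro nn_integral_Holder_interpolation p p1) auto
    also have "\<dots> = enn_powr (average Q f) p * enn_powr (average Q ?W) (1 - p)
        * (enn_powr (ennreal v) p * enn_powr (ennreal v) (1 - p))"
      using p p1 unfolding average_mult_emeasure[OF Q, symmetric] v
      by (simp add: enn_powr_mult mult_ac)
    also have "enn_powr (ennreal v) p * enn_powr (ennreal v) (1 - p) = ennreal v"
      using v by (simp add: enn_powr_ennreal flip: ennreal_mult powr_add)
    also have "enn_powr (average Q f) p * enn_powr (average Q ?W) (1 - p) * ennreal v
        \<le> enn_powr (average Q f) p * (ennreal (max 1 C) * average Q w) * ennreal v"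
      by (intro mult_right_mono mult_left_mono order_trans[OF C[OF Q]] ennreal_leI) auto
    also have "\<dots> = ennreal (max 1 C) * enn_powr (average Q f) p * (average Q w * emeasure lebesgue Q)"
      by (simp add: v mult_ac)
    finally show "(\<integral>\<^sup>+x\<in>Q. enn_powr (f x) p * w x \<partial>lebesgue)
        \<le> ennreal (max 1 C) * enn_powr (average Q f) p * (\<integral>\<^sup>+x\<in>Q. w x \<partial>lebesgue)"
      by (simp add: average_mult_emeasure[OF Q])
  qed simp
qed

theorem lemma4p6:
  fixes p :: real and w :: "real ^ 'n \<Rightarrow> ennreal"
  assumes "0 < p" and "p \<le> 1"
    and "weight w"
    and "reverse_Holder (conj_exponent (ennreal (1 / p))) w"
  shows "\<exists>C::real. \<forall>(Q :: nat \<Rightarrow> (real ^ 'n) set) (g :: nat \<Rightarrow> real ^ 'n \<Rightarrow> ennreal).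
    (\<forall>k. is_cube (Q k)) \<longrightarrow>
    (\<forall>k. g k \<in> borel_measurable lebesgue) \<longrightarrow>
    (\<forall>k. support_on UNIV (g k) \<subseteq> Q k) \<longrightarrow>
    weighted_Lp_norm p w (\<lambda>x. \<Sum>k. g k x)
      \<le> ennreal C * weighted_Lp_norm p w (\<lambda>x. \<Sum>k. average (Q k) (g k) * indicator (Q k) x)"
proof -
  have w [measurable]: "w \<in> borel_measurable lebesgue"
    using \<open>weight w\<close> by (simp add: weight_def)
  obtain A where A: "1 \<le> A" "\<And>Q f. is_cube Q \<Longrightarrow> f \<in> borel_measurable lebesgue \<Longrightarrow>
      (\<integral>\<^sup>+x\<in>Q. enn_powr (f x) p * w x \<partial>lebesgue)
        \<le> ennreal A * enn_powr (average Q f) p * (\<integral>\<^sup>+x\<in>Q. w x \<partial>lebesgue)"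
    using concave_mean_le_of_reverse_Holder[OF assms(1,2) w assms(4)] by blast
  define \<nu> where "\<nu> = density lebesgue w"
  have nu_cube: "emeasure \<nu> Q = (\<integral>\<^sup>+x\<in>Q. w x \<partial>lebesgue)" if "is_cube Q" for Q
    using that by (simp add: \<nu>_def emeasure_density)
  have nu_integral: "(\<integral>\<^sup>+x. h x \<partial>\<nu>) = (\<integral>\<^sup>+x. h x * w x \<partial>lebesgue)"
    if "h \<in> borel_measurable lebesgue" for h
    using that by (simp add: \<nu>_def nn_integral_density mult.commute)
  interpret concave_averaging p A \<nu>
  proof
    fix Q :: "(real ^ 'n) set" and f :: "real ^ 'n \<Rightarrow> ennreal"
    assume Q: "is_cube Q"
    then have "compact Q"
      by (auto simp: is_cube_def)
    then show "emeasure \<nu> Q < \<infinity>"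
      using \<open>weight w\<close> Q by (simp add: nu_cube weight_def)
    assume f [measurable]: "f \<in> borel_measurable lebesgue"
    have [measurable]: "Q \<in> sets lebesgue"
      using Q by simp
    show "(\<integral>\<^sup>+x\<in>Q. enn_powr (f x) p \<partial>\<nu>) \<le> ennreal A * enn_powr (average Q f) p * emeasure \<nu> Q"
      using A(2)[OF Q f] by (simp add: nu_integral nu_cube[OF Q] mult_ac)
  qed (use assms A in \<open>auto simp: \<nu>_def\<close>)
  obtain C where C: "0 < C"
    "\<And>(Q :: nat \<Rightarrow> (real ^ 'n) set) g. (\<And>k. is_cube (Q k)) \<Longrightarrow>
      (\<And>k. g k \<in> borel_measurable lebesgue) \<Longrightarrow> (\<And>k. support_on UNIV (g k) \<subseteq> Q k) \<Longrightarrow>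
      (\<integral>\<^sup>+x. enn_powr (\<Sum>k. g k x) p \<partial>\<nu>)
        \<le> ennreal C * (\<integral>\<^sup>+x. enn_powr (\<Sum>k. average (Q k) (g k) * indicator (Q k) x) p \<partial>\<nu>)"
    using sum_estimate by blast
  show ?thesis
  proof (intro exI[of _ "C powr (1 / p)"] allI impI)
    fix Q :: "nat \<Rightarrow> (real ^ 'n) set" and g :: "nat \<Rightarrow> real ^ 'n \<Rightarrow> ennreal"
    assume Q: "\<forall>k. is_cube (Q k)" and g: "\<forall>k. g k \<in> borel_measurable lebesgue"
      and supp: "\<forall>k. support_on UNIV (g k) \<subseteq> Q k"
    let ?G = "\<lambda>x. \<Sum>k. average (Q k) (g k) * indicator (Q k) x"
    have [measurable]: "g k \<in> borel_measurable lebesgue" "Q k \<in> sets lebesgue" for k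
      using Q g by auto
    have "(\<integral>\<^sup>+x. enn_powr (\<Sum>k. g k x) p \<partial>\<nu>) \<le> ennreal C * (\<integral>\<^sup>+x. enn_powr (?G x) p \<partial>\<nu>)"
      using Q g supp by (intro C) auto
    then have "(\<integral>\<^sup>+x. enn_powr (\<Sum>k. g k x) p * w x \<partial>lebesgue)
        \<le> ennreal C * (\<integral>\<^sup>+x. enn_powr (?G x) p * w x \<partial>lebesgue)"
      by (simp add: nu_integral)
    then have "weighted_Lp_norm p w (\<lambda>x. \<Sum>k. g k x)
        \<le> enn_powr (ennreal C * (\<integral>\<^sup>+x. enn_powr (?G x) p * w x \<partial>lebesgue)) (1 / p)"
      unfolding weighted_Lp_norm_def using \<open>0 < p\<close> by (intro enn_powr_mono) auto
    also have "\<dots> = ennreal (C powr (1 / p)) * weighted_Lp_norm p w ?G"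
      using \<open>0 < p\<close> C by (simp add: enn_powr_mult enn_powr_ennreal weighted_Lp_norm_def)
    finally show "weighted_Lp_norm p w (\<lambda>x. \<Sum>k. g k x)
        \<le> ennreal (C powr (1 / p)) * weighted_Lp_norm p w ?G" .
  qed
qed

end
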